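(* Let $m,n,r,q$ be positive integers with $rm\le n$ and $q=2^m$, let $G(x)\in\mathbb{F}_q[x]$ have degree $r$ and only distinct roots, and let $\mathcal{L}=\{f_1(x),\dots,f_n(x)\}$ be a set of $n$ irreducible polynomials in $\mathbb{F}_q[x]$ with $\gcd(f_i(x),f_j(x))=1$ for all $i\ne j$ and $\gcd(f_i(x),G(x))=1$ for all $i\in\{1,\dots,n\}$. Let $l=\max_{f(x)\in\mathcal{L}}\deg f(x)$ and $d_{\mathrm{sep}}=\frac{2r+1}{l}$, and consider the binary separable generalized Goppa code $\Gamma(\mathcal{L},G)$, with minimum Hamming distance $d(\Gamma)\ge d_{\mathrm{sep}}$. Then the syndrome-based decoding algorithm for $\Gamma(\mathcal{L},G)$ described in the context can uniquely decode any error $\mathbf{e}\in\mathbb{F}_2^n$ of Hamming weight $$t\le t_{\mathrm{sep}}:=\left\lfloor\frac{r}{l}\right\rfloor=\left\lfloor\frac{d_{\mathrm{sep}}}{2}\right\rfloor .$$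
   Context: The binary generalized Goppa code with Goppa polynomial $G$ and code locator set $\mathcal{L}$ is $$\Gamma(\mathcal{L},G)=\Bigl\{\mathbf{c}\in\mathbb{F}_2^n : \sum_{i=1}^n c_i\frac{f_i'(x)}{f_i(x)}= 0 \bmod G(x)\Bigr\},$$ where $f_i'(x)$ is the formal derivative of $f_i(x)$ and $1/f_i(x)$ denotes the inverse of $f_i(x)$ modulo $G(x)$. The code is called separable if $G(x)$ has only distinct roots. A codeword $\mathbf{c}\in\Gamma(\mathcal{L},G)$ is transmitted and $\mathbf{r}=\mathbf{c}+\mathbf{e}\in\mathbb{F}_2^n$ is received, where $\mathbf{e}$ is the error. Syndrome-based decoding algorithm. Input: the code $\Gamma(\mathcal{L},G)$ and the received word $\mathbf{r}=(r_1,\dots,r_n)\in\mathbb{F}_2^n$. 1. Calculate the syndrome polynomial $s(x)=\sum_{i=1}^n r_i\frac{f_i'(x)}{f_i(x)}\bmod G(x)$. 2. Run the extended Euclidean algorithm on $(G(x),s(x))$, with the stopping condition $\deg\omega(x)<\deg\lambda(x)\le \deg G(x)/2$, to obtain $\omega(x)$ and $\lambda(x)$; here $\omega(x)$ is the current remainder and $\lambda(x)$ the corresponding cofactor of $s(x)$, so that $\omega(x)=\lambda(x)s(x)\bmod G(x)$. 3. Set $\mathcal{E}=\{i:\lambda(\gamma_i)=0\}$, where $\gamma_i$ is a root of $f_i(x)$ in its splitting field. 4. Set the error estimate to be the vector in $\mathbb{F}_2^n$ with entry $1$ at every position $i\in\mathcal{E}$ and $0$ elsewhere. Output: $\hat{\mathbf{c}}$,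 equal to $\mathbf{r}$ minus the error estimate.
   Formalization: The decoding algorithm is run with G(x)² in place of G(x) (syndrome, Euclidean algorithm, stopping condition), using the proved equality Γ(L,G)=Γ(L,G²); with G(x) itself the claim fails, e.g. q=4, G=x, L={x−a: a≠0}, one error. *)

theory Defs
  imports
    "HOL-Algebra.Algebraic_Closure_Type"
    "HOL-Number_Theory.Cong"
    "HOL-Library.Z2"
    "HOL-Library.Extended_Real"
    "HOL-Analysis.Finite_Cartesian_Product"
begin

hide_const (open) Divisibility.irreducible Polynomials.degree

text \<open>
  Words of length \<open>n\<close> over the binary field are elements of \<open>bit ^ 'n\<close> with \<open>CARD('n) = n\<close>, and a
  code locator set \<open>{f\<^sub>1, \<dots>, f\<^sub>n}\<close> is a family \<open>L :: 'n \<Rightarrow> 'a poly\<close>.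
\<close>

definition hamming_weight :: "bit ^ 'n \<Rightarrow> nat" where
  "hamming_weight x = card {i. x $ i \<noteq> 0}"

definition hamming_dist :: "bit ^ 'n \<Rightarrow> bit ^ 'n \<Rightarrow> nat" where
  "hamming_dist x y = card {i. x $ i \<noteq> y $ i}"

text \<open>A code with at most one codeword has minimum distance \<open>\<infinity>\<close>.\<close>

definition min_distance :: "(bit ^ 'n) set \<Rightarrow> ereal" where
  "min_distance C =
     (INF (x, y) \<in> {(x, y). x \<in> C \<and> y \<in> C \<and> x \<noteq> y}. ereal (real (hamming_dist x y)))"

definition inverse_mod :: "'a::field poly \<Rightarrow> 'a poly \<Rightarrow> 'a poly" where
  "inverse_mod G f = (THE h. degree h < degree G \<and> [f * h = 1] (mod G))"

text \<open>
  In \<open>syndrome\<close>, the factor \<open>of_bool (y $ i = 1)\<close> is the image of the bit \<open>y $ i\<close> in the field \<open>'a\<close>,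
  which has characteristic 2 in the intended application.
\<close>

definition syndrome :: "('n::finite \<Rightarrow> 'a::field poly) \<Rightarrow> 'a poly \<Rightarrow> bit ^ 'n \<Rightarrow> 'a poly" where
  "syndrome L G y =
     (\<Sum>i\<in>UNIV. smult (of_bool (y $ i = 1)) (pderiv (L i) * inverse_mod G (L i))) mod G"

definition goppa_code :: "('n::finite \<Rightarrow> 'a::field poly) \<Rightarrow> 'a poly \<Rightarrow> (bit ^ 'n) set" where
  "goppa_code L G = {c. syndrome L G c = 0}"

text \<open>
  The degree with the convention that the zero polynomial has degree \<open>-\<infinity>\<close>. It matters below: if the
  syndrome is zero, the Euclidean algorithm must stop with \<open>\<omega> = 0\<close> and \<open>\<lambda> = 1\<close>.
\<close>

definition edegree :: "'a::zero poly \<Rightarrow> ereal" where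
  "edegree p = (if p = 0 then -\<infinity> else ereal (real (degree p)))"

text \<open>
  The extended Euclidean algorithm with a stopping condition. The arguments are two consecutive
  remainders \<open>a\<close>, \<open>b\<close> together with their cofactors \<open>u\<close>, \<open>v\<close>; the result is the first remainder and
  cofactor (starting with \<open>b\<close> and \<open>v\<close>) that satisfy the stopping condition, or \<open>None\<close> if the
  remainder \<open>0\<close> is reached without satisfying it.
\<close>

function ext_euclid ::
    "('a::field poly \<Rightarrow> 'a poly \<Rightarrow> bool) \<Rightarrow> 'a poly \<times> 'a poly \<Rightarrow> 'a poly \<times> 'a poly \<Rightarrow>
     ('a poly \<times> 'a poly) option" where
  "ext_euclid stop (a, u) (b, v) =
     (if stop b v then Some (b, v)
      else if b = 0 then None
      else ext_euclid stop (b, v) (a mod b, u - (a div b) * v))"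
  by auto
termination
  by (relation "measure (\<lambda>(_, _, b, _). euclidean_size b)") (auto intro: mod_size_less)

text \<open>Cofactors are those of \<open>s\<close>: the starting remainders \<open>G\<close> and \<open>s\<close> have cofactors \<open>0\<close> and \<open>1\<close>.\<close>

definition key_equation_solution ::
    "'a::field poly \<Rightarrow> 'a poly \<Rightarrow> ('a poly \<times> 'a poly) option" where
  "key_equation_solution G s =
     ext_euclid (\<lambda>\<omega> lam. edegree \<omega> < edegree lam \<and> edegree lam \<le> edegree G / 2) (G, 0) (s, 1)"

text \<open>
  A root \<open>\<gamma> i\<close> of \<open>L i\<close> in its splitting field is represented in the algebraic closure of \<open>'a\<close>, so
  that all positions can be treated in one field. Which root is chosen is left to the caller. The
  arguments \<open>L\<close> and \<open>G\<close> are the presentation of the code on which the algorithm operates.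
  A binary separable code has two presentations, by \<open>G\<close> and by \<open>G\<^sup>2\<close>. Only with the latter does the
  stopping condition \<open>deg \<lambda> \<le> deg G\<^sup>2 / 2 = deg G\<close> admit an error locator of degree up to \<open>deg G\<close>,
  hence up to \<open>\<lfloor>deg G / l\<rfloor>\<close> errors, where \<open>l\<close> is the maximal degree of the locators.
\<close>

definition syndrome_decode ::
    "('n::finite \<Rightarrow> 'a::field poly) \<Rightarrow> 'a poly \<Rightarrow> ('n \<Rightarrow> 'a alg_closure) \<Rightarrow> bit ^ 'n \<Rightarrow>
     (bit ^ 'n) option" where
  "syndrome_decode L G \<gamma> y =
     (case key_equation_solution G (syndrome L G y) of
        None \<Rightarrow> None
      | Some (\<omega>, lam) \<Rightarrow>
          (let E = {i. poly (map_poly to_ac lam) (\<gamma> i) = 0}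
           in Some (y - (\<chi> i. of_bool (i \<in> E)))))"

end

theory Submission
  imports Defs "HOL-Number_Theory.Residues"
begin

text \<open>
  Let \<open>\<sigma> = \<Prod>\<^sub>i f\<^sub>i\<close> over the support of a word \<open>y\<close>, and let \<open>s\<close> be its syndrome. The
  product rule gives the key equation \<open>\<sigma> s = \<sigma>' mod H\<close>, where \<open>H\<close> is \<open>G\<close> or \<open>G\<^sup>2\<close>; so \<open>y\<close> is a
  codeword iff \<open>H\<close> divides \<open>\<sigma>'\<close>. Over a perfect field of characteristic 2 every polynomial is
  \<open>A\<^sup>2 + x B\<^sup>2\<close>, with derivative \<open>B\<^sup>2\<close>, so for squarefree \<open>G\<close> divisibility of \<open>\<sigma>'\<close> by \<open>G\<close> and by
  \<open>G\<^sup>2\<close> are equivalent. Since \<open>\<sigma>\<close> is coprime to \<open>\<sigma>'\<close>, a nonzero codeword has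
  \<open>2 r \<le> deg \<sigma>' < deg \<sigma>\<close>, which bounds the distance. For an error with \<open>deg \<sigma> \<le> r\<close>, the pair
  \<open>(\<sigma>', \<sigma>)\<close> is the coprime solution of the key equation modulo \<open>G\<^sup>2\<close> of least degree, and the
  Euclidean algorithm stops at a scalar multiple of it; the roots of \<open>\<sigma>\<close> reveal the support.
\<close>

no_notation fps_nth (infixl \<open>$\<close> 75)

section \<open>Bezout identities and coprimality in Euclidean rings\<close>

lemma euclidean_bezout:
  fixes a b :: "'a::euclidean_ring"
  obtains d x y where "d dvd a" "d dvd b" "d = x * a + y * b"
proof -
  have "\<exists>d x y. d dvd a \<and> d dvd b \<and> d = x * a + y * b"
  proof (induction "euclidean_size b" arbitrary: a b rule: less_induct)
    case less
    show ?case
    proof (cases "b = 0")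
      case True
      then show ?thesis by (intro exI[of _ a] exI[of _ 1] exI[of _ 0]) auto
    next
      case False
      then have "euclidean_size (a mod b) < euclidean_size b"
        by (rule mod_size_less)
      from less(1)[OF this, of b] obtain d x y
        where d: "d dvd b" "d dvd a mod b" "d = x * b + y * (a mod b)" by blast
      have "d dvd a"
        using d(1,2) by (metis dvd_mod_imp_dvd)
      moreover have "d = y * a + (x - y * (a div b)) * b"
        unfolding d(3) minus_div_mult_eq_mod[symmetric] by (simp add: algebra_simps)
      ultimately show ?thesis using d(1) by blast
    qed
  qed
  then show thesis using that by blast
qed

lemma coprime_bezout:
  fixes a b :: "'a::euclidean_ring"
  assumes "coprime a b"
  obtains x y where "x * a + y * b = 1"
proof -
  obtain d x y where d: "d dvd a" "d dvd b" "d = x * a + y * b"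
    by (rule euclidean_bezout)
  then obtain e where "1 = d * e"
    using assms by (meson coprime_common_divisor dvdE)
  then have "(e * x) * a + (e * y) * b = 1"
    unfolding d(3) by (simp add: algebra_simps)
  then show thesis by (rule that)
qed

lemma coprime_dvd_multD:
  fixes a b c :: "'a::euclidean_ring"
  assumes "coprime a b" "a dvd b * c"
  shows "a dvd c"
proof -
  obtain x y where "x * a + y * b = 1"
    using assms(1) by (rule coprime_bezout)
  then have "(x * a + y * b) * c = c"
    by simp
  then have "c = a * (x * c) + y * (b * c)"
    by (simp add: algebra_simps)
  moreover have "a dvd a * (x * c) + y * (b * c)"
    using assms(2) by simp
  ultimately show ?thesis
    by simp
qed

lemma coprime_mult_rightI:
  fixes a b c :: "'a::euclidean_ring"
  assumes "coprime a b" "coprime a c"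
  shows "coprime a (b * c)"
proof (rule coprimeI)
  fix d assume d: "d dvd a" "d dvd b * c"
  have "coprime d b"
    using assms(1) d(1) by (meson coprime_divisors dvd_refl)
  then have "d dvd c" using d(2) by (rule coprime_dvd_multD)
  then show "d dvd 1" using assms(2) d(1) by (meson coprime_common_divisor)
qed

lemma coprime_prod_rightI:
  fixes f :: "'i \<Rightarrow> 'a::euclidean_ring"
  assumes "\<And>i. i \<in> A \<Longrightarrow> coprime a (f i)"
  shows "coprime a (prod f A)"
  using assms by (induction A rule: infinite_finite_induct) (auto intro: coprime_mult_rightI)

section \<open>Syndromes and the key equation\<close>

lemma inverse_mod_cong:
  fixes f H :: "'a::field poly"
  assumes "coprime f H" "degree H > 0"
  shows "[f * inverse_mod H f = 1] (mod H)"
proof -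
  obtain x y where xy: "x * f + y * H = 1"
    using assms(1) by (rule coprime_bezout)
  have ex: "degree (x mod H) < degree H"
  proof -
    have "x mod H = 0 \<or> degree (x mod H) < degree H"
      using assms(2) by (intro degree_mod_less) auto
    then show ?thesis
      using assms(2) by (elim disjE) (simp_all only: degree_0)
  qed
  have "[f * x = 1] (mod H)"
    unfolding cong_iff_dvd_diff
    by (rule dvdI[of _ _ "- y"]) (simp add: xy[symmetric] algebra_simps)
  then have inv: "[f * (x mod H) = 1] (mod H)"
    by (simp add: cong_def mod_mult_right_eq)
  have uniq: "h = x mod H" if "degree h < degree H" "[f * h = 1] (mod H)" for h
  proof -
    have "[f * h = f * (x mod H)] (mod H)"
      using that(2) cong_sym[OF inv] by (rule cong_trans)
    then have "H dvd f * (h - x mod H)"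
      unfolding cong_iff_dvd_diff right_diff_distrib .
    then have "H dvd h - x mod H"
      by (rule coprime_dvd_multD[OF coprime_commute[THEN iffD1, OF assms(1)]])
    moreover have "degree (h - x mod H) < degree H"
      using that(1) ex by (rule degree_diff_less)
    ultimately have "h - x mod H = 0"
      by (meson dvd_imp_degree_le not_le)
    then show ?thesis by simp
  qed
  \<comment> \<open>\<open>inverse_mod\<close> is a definite description, so nothing follows from
    its definition before existence (a reduced Bezout coefficient) and uniqueness (a multiple of
    \<open>H\<close> of smaller degree vanishes) are both known.\<close>
  have "\<exists>!h. degree h < degree H \<and> [f * h = 1] (mod H)"
    by (rule ex1I[of _ "x mod H"]) (use ex inv uniq in blast)+
  from theI'[OF this] show ?thesis
    unfolding inverse_mod_def by (rule conjunct2)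
qed

definition error_locator :: "('n::finite \<Rightarrow> 'a::field poly) \<Rightarrow> bit ^ 'n \<Rightarrow> 'a poly" where
  "error_locator L y = (\<Prod>i\<in>{i. y $ i = 1}. L i)"

lemma error_locator_mult_syndrome:
  fixes L :: "'n::finite \<Rightarrow> 'a::field poly"
  assumes "\<And>i. coprime (L i) H" "degree H > 0"
  shows "[error_locator L y * syndrome L H y = pderiv (error_locator L y)] (mod H)"
proof -
  define S where "S = {i. y $ i = 1}"
  have syn: "syndrome L H y = (\<Sum>i\<in>S. pderiv (L i) * inverse_mod H (L i)) mod H"
    unfolding syndrome_def S_def
    by (rule arg_cong[where f = "\<lambda>p. p mod H"], rule sum.mono_neutral_cong_right) auto
  have "[error_locator L y * syndrome L H y
      = error_locator L y * (\<Sum>i\<in>S. pderiv (L i) * inverse_mod H (L i))] (mod H)"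
    by (simp add: cong_def syn mod_mult_right_eq)
  \<comment> \<open>Splitting \<open>L i\<close> off the product makes
    \<open>L i * inverse_mod H (L i)\<close> appear, which is 1 modulo \<open>H\<close>. The
    remaining sum is the product rule for the derivative.\<close>
  also have "error_locator L y * (\<Sum>i\<in>S. pderiv (L i) * inverse_mod H (L i))
      = (\<Sum>i\<in>S. prod L (S - {i}) * pderiv (L i) * (L i * inverse_mod H (L i)))"
    unfolding error_locator_def S_def[symmetric] sum_distrib_left
  proof (rule sum.cong[OF refl])
    fix i assume "i \<in> S"
    then have "prod L S = L i * prod L (S - {i})"
      by (intro prod.remove) auto
    then show "prod L S * (pderiv (L i) * inverse_mod H (L i))
        = prod L (S - {i}) * pderiv (L i) * (L i * inverse_mod H (L i))"
      by (simp only: ac_simps)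
  qed
  also have "[\<dots> = (\<Sum>i\<in>S. prod L (S - {i}) * pderiv (L i) * 1)] (mod H)"
    by (intro cong_sum cong_mult cong_refl inverse_mod_cong assms)
  also have "(\<Sum>i\<in>S. prod L (S - {i}) * pderiv (L i) * 1) = pderiv (error_locator L y)"
    by (simp add: error_locator_def S_def[symmetric] pderiv_prod)
  finally show ?thesis .
qed

lemma coprime_error_locator:
  fixes L :: "'n::finite \<Rightarrow> 'a::field poly"
  assumes "\<And>i. coprime (L i) H"
  shows "coprime H (error_locator L y)"
  unfolding error_locator_def using assms by (auto intro: coprime_prod_rightI simp: coprime_commute)

text \<open>The locator polynomial is coprime to \<open>H\<close>, so multiplying the syndrome by it
  does not affect divisibility by \<open>H\<close>. The syndrome is already reduced, hence zero as
  soon as \<open>H\<close> divides it.\<close>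

lemma syndrome_eq_0_iff:
  fixes L :: "'n::finite \<Rightarrow> 'a::field poly"
  assumes "\<And>i. coprime (L i) H" "degree H > 0"
  shows "syndrome L H y = 0 \<longleftrightarrow> H dvd pderiv (error_locator L y)"
proof -
  let ?\<sigma> = "error_locator L y"
  have "syndrome L H y mod H = syndrome L H y"
    by (simp add: syndrome_def)
  then have "syndrome L H y = 0 \<longleftrightarrow> H dvd syndrome L H y"
    using dvd_eq_mod_eq_0[of H "syndrome L H y"] by metis
  also have "\<dots> \<longleftrightarrow> H dvd ?\<sigma> * syndrome L H y"
    using coprime_dvd_multD[OF coprime_error_locator[where L = L and y = y, OF assms(1)]] dvd_mult
    by blast
  also have "\<dots> \<longleftrightarrow> H dvd pderiv ?\<sigma>"
    using error_locator_mult_syndrome[OF assms, where y = y] 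
    by (simp only: cong_def dvd_eq_mod_eq_0)
  finally show ?thesis .
qed

text \<open>Addition of bits is compatible with addition in the field because 1 + 1 = 0 in
  characteristic 2.\<close>

lemma syndrome_add:
  fixes L :: "'n::finite \<Rightarrow> 'a::field poly"
  assumes "CHAR('a) = 2"
  shows "syndrome L H (x + y) = (syndrome L H x + syndrome L H y) mod H"
proof -
  have two: "(2::'a) = 0"
    using assms by (metis of_nat_CHAR of_nat_numeral)
  have "(of_bool ((x + y) $ i = 1) :: 'a) = of_bool (x $ i = 1) + of_bool (y $ i = 1)" for i
    by (cases "x $ i"; cases "y $ i") (auto simp: two)
  then show ?thesis
    by (simp add: syndrome_def smult_add_left sum.distrib mod_add_eq)
qed

lemma syndrome_codeword_add:
  fixes L :: "'n::finite \<Rightarrow> 'a::field poly"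
  assumes "CHAR('a) = 2" "c \<in> goppa_code L H"
  shows "syndrome L H (c + y) = syndrome L H y"
  using assms by (simp add: syndrome_add goppa_code_def) (simp add: syndrome_def)

section \<open>Polynomials and derivatives in characteristic 2\<close>

lemma char_2_decomp:
  fixes p :: "'a::comm_semiring_1 poly"
  assumes "CHAR('a) = 2" "\<And>a::'a. \<exists>b. b ^ 2 = a"
  obtains A B where "p = A ^ 2 + monom 1 1 * B ^ 2"
proof -
  have two: "(2::'a poly) = 0"
    using assms(1) by (metis semiring_char_poly of_nat_CHAR of_nat_numeral)
  have "\<exists>A B. p = A ^ 2 + monom 1 1 * B ^ 2"
  proof (induction p)
    case 0
    then show ?case by (intro exI[of _ 0]) simp
  next
    case (pCons a p)
    then obtain A B where p: "p = A ^ 2 + monom 1 1 * B ^ 2" by blast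
    obtain b where b: "b ^ 2 = a" using assms(2) by blast
    have "pCons a p = [:b:] ^ 2 + monom 1 1 * p"
      by (simp add: b[symmetric] power2_eq_square monom_Suc)
    \<comment> \<open>Multiplication by x exchanges the two parts: x A^2 is the new odd part, and x
      (x B^2) = (x B)^2 joins the square of the constant b, squaring being additive.\<close>
    also have "\<dots> = ([:b:] + monom 1 1 * B) ^ 2 + monom 1 1 * A ^ 2"
      by (simp add: p power2_sum two power_mult_distrib) (simp add: power2_eq_square algebra_simps)
    finally show ?case by blast
  qed
  then show thesis using that by blast
qed

text \<open>The derivative of a square carries a factor 2 and vanishes, so only the derivative of
  the factor x survives.\<close>

lemma char_2_pderiv:
  fixes A B :: "'a::idom poly"
  assumes "CHAR('a) = 2"
  shows "pderiv (A ^ 2 + monom 1 1 * B ^ 2) = B ^ 2"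
proof -
  have two: "(2::'a poly) = 0"
    using assms by (metis semiring_char_poly of_nat_CHAR of_nat_numeral)
  have two': "(2::'a) = 0"
    using assms by (metis of_nat_CHAR of_nat_numeral)
  show ?thesis
    by (simp add: pderiv_add pderiv_mult pderiv_power pderiv_monom two two' of_nat_numeral)
qed

section \<open>Coprimality of a product of distinct irreducibles to its derivative\<close>

lemma coprime_irreducible_iff:
  fixes p :: "'a::algebraic_semidom"
  assumes "irreducible p"
  shows "coprime p a \<longleftrightarrow> \<not> p dvd a"
proof
  assume "coprime p a"
  then show "\<not> p dvd a"
    using irreducible_not_unit[OF assms] coprime_common_divisor[of p a p] by auto
next
  assume not_dvd: "\<not> p dvd a"
  show "coprime p a"
  proof (rule coprimeI)
    fix d assume d: "d dvd p" "d dvd a"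
    have "\<not> p dvd d"
      using not_dvd d(2) dvd_trans by blast
    then show "d dvd 1"
      using irreducibleD'[OF assms d(1)] by blast
  qed
qed

lemma irreducible_degree_pos:
  fixes p :: "'a::field poly"
  assumes "irreducible p"
  shows "degree p > 0"
proof -
  have "p \<noteq> 0"
    using assms by auto
  then show ?thesis
    using irreducible_not_unit[OF assms] is_unit_iff_degree[of p] by blast
qed

lemma degree_pderiv_less:
  fixes p :: "'a::idom poly"
  assumes "pderiv p \<noteq> 0"
  shows "degree (pderiv p) < degree p"
proof -
  have "degree (pderiv p) \<le> degree p - 1"
    by (intro degree_le) (auto simp: coeff_pderiv coeff_eq_0)
  moreover have "degree p \<noteq> 0"
    using assms pderiv_singleton by (metis degree_eq_zeroE)
  ultimately show ?thesis by linarith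
qed

text \<open>With zero derivative, \<open>p\<close> would be the square A^2, which is not
  irreducible. With nonzero derivative, \<open>p\<close> cannot divide it for reasons of
  degree.\<close>

lemma coprime_pderiv_irreducible:
  fixes p :: "'a::field poly"
  assumes "CHAR('a) = 2" "\<And>a::'a. \<exists>b. b ^ 2 = a" "irreducible p"
  shows "coprime p (pderiv p)"
proof -
  obtain A B where AB: "p = A ^ 2 + monom 1 1 * B ^ 2"
    using char_2_decomp[OF assms(1,2)] by blast
  have "pderiv p \<noteq> 0"
  proof
    assume "pderiv p = 0"
    then have "p = A * A"
      using char_2_pderiv[OF assms(1), of A B] AB by (simp add: power2_eq_square)
    then have "A dvd 1"
      using irreducibleD[OF assms(3), of A A] by blast
    then have "p dvd 1"
      using \<open>p = A * A\<close> is_unit_mult_iff[of A A] by simp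
    then show False
      using irreducible_not_unit[OF assms(3)] by blast
  qed
  then have "\<not> p dvd pderiv p"
    using degree_pderiv_less[of p] dvd_imp_degree_le[of p "pderiv p"] by (meson not_le)
  then show ?thesis
    using assms(3) by (simp add: coprime_irreducible_iff)
qed

lemma coprime_pderiv_mult:
  fixes p q :: "'a::field poly"
  assumes "coprime p q" "coprime p (pderiv p)" "coprime q (pderiv q)"
  shows "coprime (p * q) (pderiv (p * q))"
proof -
  \<comment> \<open>Modulo \<open>f\<close>, the derivative of \<open>f * g\<close> is
    \<open>g * pderiv f\<close>, a product of two elements coprime to \<open>f\<close>.\<close>
  have *: "coprime f (pderiv (f * g))" if "coprime f g" "coprime f (pderiv f)" for f g :: "'a poly"
  proof (rule coprimeI)
    fix d assume d: "d dvd f" "d dvd pderiv (f * g)"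
    then have "d dvd f * pderiv g + g * pderiv f" by (simp add: pderiv_mult)
    then have "d dvd g * pderiv f"
      using dvd_add_right_iff[of d "f * pderiv g" "g * pderiv f"] d(1) by simp
    moreover have "coprime f (g * pderiv f)"
      using that by (rule coprime_mult_rightI)
    ultimately show "d dvd 1"
      using d(1) by (blast intro: coprime_common_divisor)
  qed
  have "coprime (pderiv (p * q)) (p * q)"
  proof (rule coprime_mult_rightI)
    show "coprime (pderiv (p * q)) p"
      using *[of p q] assms(1,2) coprime_commute by blast
    show "coprime (pderiv (p * q)) q"
      using *[of q p] assms(1,3) coprime_commute unfolding mult.commute[of q p] by blast
  qed
  then show ?thesis by (simp add: coprime_commute)
qed

lemma coprime_pderiv_prod:
  fixes f :: "'i \<Rightarrow> 'a::field poly"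
  assumes "finite S" "\<And>i. i \<in> S \<Longrightarrow> coprime (f i) (pderiv (f i))"
    and "\<And>i j. i \<in> S \<Longrightarrow> j \<in> S \<Longrightarrow> i \<noteq> j \<Longrightarrow> coprime (f i) (f j)"
  shows "coprime (prod f S) (pderiv (prod f S))"
  using assms
proof (induction S rule: finite_induct)
  case (insert i S)
  have "coprime (f i) (prod f S)"
    using insert by (intro coprime_prod_rightI) auto
  then have "coprime (f i * prod f S) (pderiv (f i * prod f S))"
    by (rule coprime_pderiv_mult) (use insert in blast)+
  then show ?case
    by (simp only: prod.insert[OF insert.hyps])
qed simp

section \<open>Passage to the algebraic closure and polynomials with distinct roots\<close>

lemma map_poly_to_ac_mult:
  "map_poly to_ac (p * q) = map_poly to_ac p * map_poly to_ac (q :: 'a::field poly)"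
  by (rule poly_eqI) (simp add: coeff_map_poly coeff_mult to_ac_sum)

lemma map_poly_to_ac_add:
  "map_poly to_ac (p + q) = map_poly to_ac p + map_poly to_ac (q :: 'a::field poly)"
  by (rule poly_eqI) (simp add: coeff_map_poly)

lemma map_poly_to_ac_prod:
  "map_poly to_ac (prod f A) = (\<Prod>i\<in>A. map_poly to_ac (f i :: 'a::field poly))"
  by (induction A rule: infinite_finite_induct) (simp_all add: map_poly_to_ac_mult map_poly_1')

lemma coprime_no_common_root:
  fixes p q :: "'a::field poly"
  assumes "coprime p q" "poly (map_poly to_ac p) x = 0"
  shows "poly (map_poly to_ac q) x \<noteq> 0"
proof
  assume q: "poly (map_poly to_ac q) x = 0"
  obtain a b where "a * p + b * q = 1"
    using assms(1) by (rule coprime_bezout)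
  then have "poly (map_poly to_ac (a * p + b * q)) x = 1"
    by (simp add: map_poly_1')
  with assms(2) q show False
    by (simp add: map_poly_to_ac_mult map_poly_to_ac_add)
qed

text \<open>Let d be a greatest common divisor of \<open>p\<close> and \<open>q\<close>, and write p
  = d p', q = d q' with p', q' coprime. From p | q^2 it follows that p' | d, so p'^2 divides p.
  Distinct roots then force p' to be constant, and \<open>p\<close> divides d.\<close>

lemma rsquarefree_dvd_power2D:
  fixes p q :: "'a::field poly"
  assumes "rsquarefree (map_poly to_ac p)" "p dvd q ^ 2"
  shows "p dvd q"
proof -
  obtain d x y where d: "d dvd p" "d dvd q" "d = x * p + y * q"
    by (rule euclidean_bezout)
  obtain p' where p': "p = d * p'" using d(1) by (rule dvdE)
  obtain q' where q': "q = d * q'" using d(2) by (rule dvdE)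
  have "p \<noteq> 0" using assms(1) by (auto simp: rsquarefree_def)
  then have "d \<noteq> 0" "p' \<noteq> 0" using p' by auto
  have "d * (x * p' + y * q') = d * 1"
    using d(3) p' q' by (simp add: algebra_simps)
  then have "x * p' + y * q' = 1"
    using \<open>d \<noteq> 0\<close> by (simp only: mult_cancel_left) simp
  then have cop: "coprime p' q'"
    using dvd_add[OF dvd_mult dvd_mult, of _ p' q' x y] by (auto intro: coprimeI)
  have "d * p' dvd d * (q' * (q' * d))"
    using assms(2) by (simp add: p' q' power2_eq_square ac_simps)
  then have "p' dvd q' * (q' * d)"
    using \<open>d \<noteq> 0\<close> by (simp only: dvd_mult_cancel_left) simp
  then have "p' dvd d"
    using cop by (blast intro: coprime_dvd_multD)
  have "degree p' = 0"
  proof (rule ccontr)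
    assume "degree p' \<noteq> 0"
    then have "degree (map_poly to_ac p') > 0" by (simp add: degree_map_poly)
    then obtain a where a: "poly (map_poly to_ac p') a = 0"
      using alg_closed_imp_poly_has_root by blast
    obtain e where e: "d = p' * e" using \<open>p' dvd d\<close> by (rule dvdE)
    let ?P = "map_poly to_ac p'" and ?E = "map_poly to_ac e"
    have eq: "map_poly to_ac p = ?P * ?P * ?E"
      by (simp add: p' e map_poly_to_ac_mult ac_simps)
    then have nz: "?P * ?P * ?E \<noteq> 0"
      using assms(1) by (simp add: rsquarefree_def)
    then have "order a (map_poly to_ac p) = order a ?P + order a ?P + order a ?E"
      unfolding eq by (simp add: order_mult)
    \<comment> \<open>A root of p' would be a root of \<open>p\<close> of multiplicity at least
      2.\<close>
    moreover have "order a ?P \<noteq> 0"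
      using a nz by (simp add: order_root)
    moreover have "order a (map_poly to_ac p) \<le> 1"
      using assms(1) by (auto simp: rsquarefree_def dest: spec[of _ a])
    ultimately show False by linarith
  qed
  then have "p' dvd 1"
    using \<open>p' \<noteq> 0\<close> by (simp add: is_unit_iff_degree)
  then have "p dvd d" unfolding p' by (simp add: mult_unit_dvd_iff)
  then show ?thesis using d(2) by (rule dvd_trans)
qed

lemma power2_dvd_pderiv:
  fixes G p :: "'a::field poly"
  assumes "CHAR('a) = 2" "\<And>a::'a. \<exists>b. b ^ 2 = a" "rsquarefree (map_poly to_ac G)"
    and "G dvd pderiv p"
  shows "G ^ 2 dvd pderiv p"
proof -
  obtain A B where AB: "p = A ^ 2 + monom 1 1 * B ^ 2"
    using char_2_decomp[OF assms(1,2)] by blast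
  then have B: "pderiv p = B ^ 2"
    using char_2_pderiv[OF assms(1)] by simp
  then have "G dvd B"
    using assms(3,4) by (auto intro: rsquarefree_dvd_power2D)
  then show ?thesis by (simp add: B dvd_power_same)
qed

section \<open>The presentation by \<open>G ^ 2\<close>, locator degrees and the minimum
  distance\<close>

lemma goppa_code_power2:
  fixes L :: "'n::finite \<Rightarrow> 'a::field poly"
  assumes "CHAR('a) = 2" "\<And>a::'a. \<exists>b. b ^ 2 = a" "rsquarefree (map_poly to_ac G)"
    and "\<And>i. coprime (L i) G" "degree G > 0"
  shows "goppa_code L (G ^ 2) = goppa_code L G"
proof -
  have "coprime (L i) (G ^ 2)" for i
    using assms(4) by (auto simp: power2_eq_square intro: coprime_mult_rightI)
  moreover have "degree (G ^ 2) > 0"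
    using assms(5) by (subst degree_power_eq) auto
  moreover have "G ^ 2 dvd pderiv p \<longleftrightarrow> G dvd pderiv p" for p
    using power2_dvd_pderiv[OF assms(1-3)] dvd_trans[OF dvd_power[of 2 G]] by auto
  ultimately show ?thesis
    using assms(4,5) by (simp add: goppa_code_def syndrome_eq_0_iff)
qed

lemma bit_neq_0_iff: "(b::bit) \<noteq> 0 \<longleftrightarrow> b = 1"
  by (cases b) auto

lemma degree_error_locator_le:
  fixes L :: "'n::finite \<Rightarrow> 'a::field poly"
  assumes "\<And>i. degree (L i) \<le> l"
  shows "degree (error_locator L y) \<le> l * hamming_weight y"
proof -
  have "degree (error_locator L y) \<le> (\<Sum>i\<in>{i. y $ i = 1}. degree (L i))"
    unfolding error_locator_def using degree_prod_sum_le[of "{i. y $ i = 1}" L] by (simp add: comp_def)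
  also have "\<dots> \<le> card {i. y $ i = 1} * l"
    using sum_bounded_above[of "{i. y $ i = 1}" "\<lambda>i. degree (L i)" l] assms by simp
  finally show ?thesis
    by (simp add: hamming_weight_def bit_neq_0_iff mult.commute)
qed

lemma degree_error_locator_pos:
  fixes L :: "'n::finite \<Rightarrow> 'a::field poly"
  assumes "\<And>i. irreducible (L i)" "y \<noteq> 0"
  shows "degree (error_locator L y) > 0"
proof -
  obtain i where i: "y $ i = 1"
    using assms(2) by (metis bit_neq_0_iff vec_eq_iff zero_index)
  have nz: "L j \<noteq> 0" for j
    using assms(1)[of j] by auto
  have "0 < degree (L i)"
    using assms(1) by (rule irreducible_degree_pos)
  also have "degree (L i) \<le> (\<Sum>j\<in>{j. y $ j = 1}. degree (L j))"
    using i by (intro member_le_sum) auto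
  also have "\<dots> = degree (error_locator L y)"
    unfolding error_locator_def using nz by (intro degree_prod_sum_eq[symmetric])
  finally show ?thesis .
qed

lemma coprime_pderiv_error_locator:
  fixes L :: "'n::finite \<Rightarrow> 'a::field poly"
  assumes "CHAR('a) = 2" "\<And>a::'a. \<exists>b. b ^ 2 = a" "\<And>i. irreducible (L i)"
    and "\<And>i j. i \<noteq> j \<Longrightarrow> coprime (L i) (L j)"
  shows "coprime (error_locator L y) (pderiv (error_locator L y))"
  unfolding error_locator_def
  using assms by (intro coprime_pderiv_prod coprime_pderiv_irreducible) auto

lemma hamming_weight_codeword:
  fixes L :: "'n::finite \<Rightarrow> 'a::field poly"
  assumes "CHAR('a) = 2" "\<And>a::'a. \<exists>b. b ^ 2 = a" "rsquarefree (map_poly to_ac G)"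
    and "\<And>i. irreducible (L i)" "\<And>i j. i \<noteq> j \<Longrightarrow> coprime (L i) (L j)"
    and "\<And>i. coprime (L i) G" "degree G > 0" "\<And>i. degree (L i) \<le> l"
    and "c \<in> goppa_code L G" "c \<noteq> 0"
  shows "2 * degree G + 1 \<le> l * hamming_weight c"
proof -
  let ?\<sigma> = "error_locator L c"
  have pos: "degree ?\<sigma> > 0"
    using assms(4,10) by (rule degree_error_locator_pos)
  \<comment> \<open>Divisibility by \<open>G ^ 2\<close> bounds the degree of the derivative only if
    the derivative is nonzero.\<close>
  have nz: "pderiv ?\<sigma> \<noteq> 0"
  proof
    assume "pderiv ?\<sigma> = 0"
    then have "?\<sigma> dvd 1"
      using coprime_pderiv_error_locator[where L = L and y = c, OF assms(1,2,4,5)]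
      by (simp add: coprime_0_right_iff)
    then show False
      using pos is_unit_iff_degree[of ?\<sigma>] by force
  qed
  have "G dvd pderiv ?\<sigma>"
    using assms(6,7,9) by (simp add: goppa_code_def syndrome_eq_0_iff)
  then have "G ^ 2 dvd pderiv ?\<sigma>"
    by (rule power2_dvd_pderiv[OF assms(1-3)])
  then have "degree (G ^ 2) \<le> degree (pderiv ?\<sigma>)"
    using nz by (rule dvd_imp_degree_le)
  also have "degree (G ^ 2) = 2 * degree G"
    using assms(7) by (intro degree_power_eq) auto
  \<comment> \<open>The summand 1 in the bound comes from the strict drop of the degree under
    differentiation.\<close>
  finally show ?thesis
    using degree_pderiv_less[OF nz] degree_error_locator_le[of L l c] assms(8) by fastforce
qed

section \<open>The Euclidean algorithm and solutions of the key equation\<close>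

lemma edegree_less_iff:
  "edegree p < edegree q \<longleftrightarrow> q \<noteq> 0 \<and> (p = 0 \<or> degree p < degree q)"
  by (auto simp: edegree_def)

lemma edegree_le_half_iff:
  assumes "q \<noteq> 0" "p \<noteq> 0"
  shows "edegree q \<le> edegree p / 2 \<longleftrightarrow> 2 * degree q \<le> degree p"
proof -
  have "edegree q \<le> edegree p / 2 \<longleftrightarrow> ereal (real (degree q)) \<le> ereal (real (degree p) / 2)"
    using assms by (simp add: edegree_def)
  also have "\<dots> \<longleftrightarrow> 2 * degree q \<le> degree p"
    by auto
  finally show ?thesis .
qed

lemma degree_div_add:
  fixes a b :: "'a::field poly"
  assumes "b \<noteq> 0" "degree b \<le> degree a" "a \<noteq> 0"
  shows "degree (a div b) + degree b = degree a"
proof (cases "a mod b = 0")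
  case True
  then have a: "a = a div b * b"
    using div_mult_mod_eq[of a b] by simp
  then have "a div b \<noteq> 0" using assms(3) by auto
  then have "degree (a div b * b) = degree (a div b) + degree b"
    using assms(1) by (rule degree_mult_eq)
  then show ?thesis using a by simp
next
  case False
  then have less: "degree (a mod b) < degree b"
    using assms(1) by (intro degree_mod_less')
  have eq: "a div b * b = a - a mod b"
    by (simp add: minus_mod_eq_div_mult)
  have deg: "degree (a - a mod b) = degree a"
    using degree_add_eq_left[of "- (a mod b)" a] less assms(2) by simp
  then have "a div b \<noteq> 0"
    using eq less assms(2) by (metis degree_0 less_le_trans mult_zero_left not_less_zero)
  then have "degree (a div b * b) = degree (a div b) + degree b"
    using assms(1) by (rule degree_mult_eq)
  then show ?thesis using eq deg by simp
qed

text \<open>Cross-multiplying the two congruences gives \<omega> v = \<sigma> b modulo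
  \<open>H\<close>. Both sides have degree below that of \<open>H\<close>, so they are equal.
  Coprimality gives \<sigma> | v, and the degree bound on v makes the quotient a scalar.\<close>

lemma key_equation_multiple:
  fixes H s \<omega> \<sigma> b v :: "'a::field poly"
  assumes "coprime \<sigma> \<omega>" "[\<sigma> * s = \<omega>] (mod H)" "degree H > 0"
    and "\<omega> = 0 \<or> degree \<omega> < degree \<sigma>" "2 * degree \<sigma> \<le> degree H"
    and "[v * s = b] (mod H)" "v \<noteq> 0" "degree v \<le> degree \<sigma>"
    and "b = 0 \<or> degree b + degree \<sigma> < degree H"
  obtains k where "k \<noteq> 0" "v = smult k \<sigma>" "b = smult k \<omega>"
proof -
  have "[\<omega> * v = \<sigma> * s * v] (mod H)"
    using assms(2) by (intro cong_mult cong_refl) (rule cong_sym)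
  also have "\<sigma> * s * v = \<sigma> * (v * s)" by (simp only: ac_simps)
  also have "[\<sigma> * (v * s) = \<sigma> * b] (mod H)"
    using assms(6) by (intro cong_mult cong_refl)
  finally have dvd: "H dvd \<omega> * v - \<sigma> * b"
    by (simp only: cong_iff_dvd_diff)
  have "degree (\<omega> * v) < degree H"
    using assms(3,4,5,8) degree_mult_le[of \<omega> v] by auto
  moreover have "degree (\<sigma> * b) < degree H"
    using assms(3,9) degree_mult_le[of \<sigma> b] by auto
  ultimately have "degree (\<omega> * v - \<sigma> * b) < degree H"
    by (rule degree_diff_less)
  with dvd have "\<omega> * v - \<sigma> * b = 0"
    by (meson dvd_imp_degree_le not_le)
  then have eq: "\<omega> * v = \<sigma> * b" by simp
  have "\<sigma> dvd \<omega> * v"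
    unfolding eq by (rule dvd_triv_left)
  with assms(1) have "\<sigma> dvd v"
    by (rule coprime_dvd_multD)
  then obtain p where p: "v = \<sigma> * p" by (rule dvdE)
  have nz: "\<sigma> \<noteq> 0" "p \<noteq> 0" using assms(7) p by auto
  then have "degree v = degree \<sigma> + degree p"
    unfolding p by (rule degree_mult_eq)
  then have "degree p = 0" using assms(8) by simp
  then obtain k where k: "p = [:k:]" by (rule degree_eq_zeroE)
  have "\<sigma> * b = \<sigma> * smult k \<omega>"
    using eq p k by (simp add: mult.commute)
  then have "b = smult k \<omega>" using nz(1) by (simp only: mult_cancel_left) simp
  moreover have "v = smult k \<sigma>" using p k by simp
  moreover have "k \<noteq> 0" using k nz(2) by auto
  ultimately show thesis using that by blast
qed

text \<open>
  The degree of the cofactor grows exactly as fast as the degree of the remainder drops. The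
  cofactor therefore cannot jump over \<open>degree \<sigma>\<close>: a state from which it would has to be a scalar
  multiple of \<open>(\<omega>, \<sigma>)\<close>, where the algorithm stops.
\<close>

lemma ext_euclid_key_equation:
  fixes H s \<omega> \<sigma> a u b v :: "'a::field poly"
  defines "stop \<equiv> \<lambda>\<omega> lam. edegree \<omega> < edegree lam \<and> edegree lam \<le> edegree H / 2"
  assumes "coprime \<sigma> \<omega>" "[\<sigma> * s = \<omega>] (mod H)" "degree H > 0"
    and "\<omega> = 0 \<or> degree \<omega> < degree \<sigma>" "2 * degree \<sigma> \<le> degree H" "\<sigma> \<noteq> 0"
    and "[u * s = a] (mod H)" "[v * s = b] (mod H)"
    and "b = 0 \<or> degree b < degree a" "degree u \<le> degree v" "v \<noteq> 0"
    and "degree v + degree a = degree H" "degree v \<le> degree \<sigma>"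
  shows "\<exists>k. k \<noteq> 0 \<and> ext_euclid stop (a, u) (b, v) = Some (smult k \<omega>, smult k \<sigma>)"
  using assms(8-)
proof (induction "euclidean_size b" arbitrary: a u b v rule: less_induct)
  case less
  have nzH: "H \<noteq> 0" using assms(4) by auto
  have stop_iff: "stop p q \<longleftrightarrow> q \<noteq> 0 \<and> (p = 0 \<or> degree p < degree q) \<and> 2 * degree q \<le> degree H"
    for p q
    unfolding stop_def edegree_less_iff using nzH edegree_le_half_iff[of q H] by blast
  show ?case
  proof (cases "stop b v")
    case True
    \<comment> \<open>Stopping gives deg b < deg v \<le> deg \<sigma>, so the sum of degrees is
      below 2 deg \<sigma> \<le> deg H.\<close>
    have "b = 0 \<or> degree b + degree \<sigma> < degree H"
      using True less.prems(7) assms(6) by (auto simp: stop_iff)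
    then obtain k where "k \<noteq> 0" "v = smult k \<sigma>" "b = smult k \<omega>"
      using key_equation_multiple[OF assms(2-6) less.prems(2,5,7)] by blast
    then show ?thesis using True by (subst ext_euclid.simps) auto
  next
    case False
    \<comment> \<open>A zero remainder would meet the stopping condition, since deg v \<le> deg
      \<sigma> \<le> deg H / 2. So the result \<open>None\<close> never occurs.\<close>
    then have b: "b \<noteq> 0"
      using less.prems(5,7) assms(6) by (auto simp: stop_iff)
    then have deg: "degree b < degree a" using less.prems(3) by simp
    let ?q = "a div b" and ?v = "u - (a div b) * v"
    have "a \<noteq> 0" using deg by auto
    then have q: "degree ?q + degree b = degree a"
      using b deg by (intro degree_div_add) auto
    then have "degree ?q > 0" using deg by linarith
    then have "?q \<noteq> 0" by auto
    then have "degree (?q * v) = degree ?q + degree v"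
      using less.prems(5) by (rule degree_mult_eq)
    \<comment> \<open>No cancellation occurs: the quotient has positive degree, so deg u \<le> deg v
      < deg (\<open>?q * v\<close>).\<close>
    then have degv: "degree ?v = degree ?q + degree v"
      using degree_add_eq_right[of u "- (?q * v)"] less.prems(4) \<open>degree ?q > 0\<close> by simp
    have bound: "degree ?v \<le> degree \<sigma>"
    proof (rule ccontr)
      assume "\<not> degree ?v \<le> degree \<sigma>"
      \<comment> \<open>The degrees of the next cofactor and of b add up to deg H, so overshooting
        deg \<sigma> makes deg b small enough for \<open>key_equation_multiple\<close>.\<close>
      then have "degree b + degree \<sigma> < degree H"
        using degv q less.prems(6) by linarith
      then obtain k where "k \<noteq> 0" "v = smult k \<sigma>" "b = smult k \<omega>"
        using key_equation_multiple[OF assms(2-6) less.prems(2,5,7)] by blast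
      then have "stop b v"
        using assms(5-7) by (auto simp: stop_iff)
      with False show False by blast
    qed
    have "[u * s - ?q * (v * s) = a - ?q * b] (mod H)"
      using less.prems(1,2) by (intro cong_diff cong_mult cong_refl)
    moreover have "u * s - ?q * (v * s) = ?v * s"
      by (simp add: algebra_simps)
    moreover have "a - ?q * b = a mod b"
      by (simp add: minus_div_mult_eq_mod)
    ultimately have cong: "[?v * s = a mod b] (mod H)" by simp
    have "\<exists>k. k \<noteq> 0 \<and> ext_euclid stop (b, v) (a mod b, ?v) = Some (smult k \<omega>, smult k \<sigma>)"
    proof (rule less.hyps)
      show "euclidean_size (a mod b) < euclidean_size b"
        using b by (rule mod_size_less)
      show "a mod b = 0 \<or> degree (a mod b) < degree b"
        using b by (rule degree_mod_less)
      show "degree v \<le> degree ?v" "degree ?v + degree b = degree H"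
        using degv q less.prems(6) by linarith+
      show "?v \<noteq> 0"
        using degv \<open>degree ?q > 0\<close> by (metis add_gr_0 degree_0 less_irrefl)
    qed (fact less.prems(2) cong bound)+
    then show ?thesis
      using False b by (subst ext_euclid.simps) simp
  qed
qed

text \<open>The starting pairs \<open>(H, 0)\<close> and \<open>(s, 1)\<close> satisfy the loop
  invariants: 0 is congruent to \<open>H\<close> modulo \<open>H\<close>, and the cofactor 1 has
  degree 0.\<close>

lemma key_equation_solution_eq:
  fixes H s \<omega> \<sigma> :: "'a::field poly"
  assumes "coprime \<sigma> \<omega>" "[\<sigma> * s = \<omega>] (mod H)" "degree H > 0"
    and "\<omega> = 0 \<or> degree \<omega> < degree \<sigma>" "2 * degree \<sigma> \<le> degree H" "\<sigma> \<noteq> 0"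
    and "s = 0 \<or> degree s < degree H"
  shows "\<exists>k. k \<noteq> 0 \<and> key_equation_solution H s = Some (smult k \<omega>, smult k \<sigma>)"
  unfolding key_equation_solution_def
  by (rule ext_euclid_key_equation[OF assms(1-6), of 0 H 1 s])
    (use assms(7) in \<open>simp_all add: cong_def\<close>)

section \<open>Correctness of the decoder\<close>

lemma syndrome_decode_correct:
  fixes L :: "'n::finite \<Rightarrow> 'a::field poly" and \<gamma> :: "'n \<Rightarrow> 'a alg_closure"
  assumes "CHAR('a) = 2" "\<And>a::'a. \<exists>b. b ^ 2 = a"
    and "\<And>i. irreducible (L i)" "\<And>i j. i \<noteq> j \<Longrightarrow> coprime (L i) (L j)"
    and "\<And>i. coprime (L i) H" "degree H > 0"
    and "\<And>i. poly (map_poly to_ac (L i)) (\<gamma> i) = 0"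
    and "c \<in> goppa_code L H" "2 * degree (error_locator L e) \<le> degree H"
  shows "syndrome_decode L H \<gamma> (c + e) = Some c"
proof -
  let ?\<sigma> = "error_locator L e" and ?s = "syndrome L H e"
  have nz: "?\<sigma> \<noteq> 0"
  proof -
    have "L i \<noteq> 0" for i
      using assms(3)[of i] by auto
    then show ?thesis by (simp add: error_locator_def)
  qed
  have "?s = 0 \<or> degree ?s < degree H"
    unfolding syndrome_def using assms(6) by (intro degree_mod_less) auto
  \<comment> \<open>The zero case is that of no error: then \<sigma> = 1, and the algorithm must
    return the remainder 0.\<close>
  moreover have "pderiv ?\<sigma> = 0 \<or> degree (pderiv ?\<sigma>) < degree ?\<sigma>"
    using degree_pderiv_less by blast
  ultimately obtain k where k: "k \<noteq> 0"
    "key_equation_solution H ?s = Some (smult k (pderiv ?\<sigma>), smult k ?\<sigma>)"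
    using key_equation_solution_eq[OF coprime_pderiv_error_locator[where L = L and y = e, OF assms(1-4)]
        error_locator_mult_syndrome[OF assms(5,6)] assms(6) _ assms(9) nz] by blast
  \<comment> \<open>Coprime locators share no root, so any chosen root of \<open>L i\<close>
    identifies the position i.\<close>
  have root_L: "poly (map_poly to_ac (L j)) (\<gamma> i) = 0 \<longleftrightarrow> j = i" for i j
    using assms(4,7) coprime_no_common_root by blast
  have "poly (map_poly to_ac (smult k ?\<sigma>)) x = to_ac k * poly (map_poly to_ac ?\<sigma>) x" for x
    using map_poly_to_ac_mult[of "[:k:]" ?\<sigma>] by (simp add: map_poly_pCons)
  then have roots: "poly (map_poly to_ac (smult k ?\<sigma>)) (\<gamma> i) = 0 \<longleftrightarrow> e $ i = 1" for i
    using k(1) by (simp add: error_locator_def map_poly_to_ac_prod poly_prod root_L)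
  have "(of_bool (b = 1) :: bit) = b" for b
    by (cases b) auto
  then have "(\<chi> i. of_bool (e $ i = 1)) = e"
    by (simp add: vec_eq_iff)
  then show ?thesis
    using k(2) assms(1,8)
    by (simp add: syndrome_decode_def syndrome_codeword_add roots)
qed

section \<open>Finite fields with 2^m elements\<close>

lemma char_2_exists_sqrt:
  fixes a :: "'a::{field,finite}"
  assumes "CHAR('a) = 2"
  shows "\<exists>b. b ^ 2 = a"
proof -
  have two: "(2::'a) = 0"
    using assms by (metis of_nat_CHAR of_nat_numeral)
  \<comment> \<open>Finiteness turns injectivity of squaring into the existence of square
    roots.\<close>
  have "inj (\<lambda>b::'a. b ^ 2)"
  proof (rule injI)
    fix x y :: 'a
    assume "x ^ 2 = y ^ 2"
    then have "(x - y) ^ 2 = 2 * (y * y - x * y)"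
      by (simp add: power2_eq_square algebra_simps)
    then show "x = y"
      by (simp add: two)
  qed
  then have "surj (\<lambda>b::'a. b ^ 2)"
    by (rule finite_UNIV_inj_surj[OF finite_class.finite_UNIV])
  then show ?thesis
    by (metis surjD)
qed

lemma CHAR_eq_2:
  assumes "CARD('a::{field,finite}) = 2 ^ m"
  shows "CHAR('a) = 2"
proof -
  have "CHAR('a) > 0"
    by (rule finite_imp_CHAR_pos) simp
  then have "prime CHAR('a)"
    by (rule prime_CHAR_semidom)
  moreover have "CHAR('a) dvd 2 ^ m"
    using CHAR_dvd_CARD[where 'a = 'a] assms by simp
  ultimately show ?thesis
    using prime_dvd_power[of "CHAR('a)" 2 m] primes_dvd_imp_eq two_is_prime_nat by blast
qed

section \<open>Minimum distance, decoding radius and unique decoding\<close>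

theorem theorem4:
  fixes G :: "'a::{field,finite} poly"
    and L :: "'n::finite \<Rightarrow> 'a poly"
    and \<gamma> :: "'n \<Rightarrow> 'a alg_closure"
    and m n r q l :: nat
    and d_sep :: real
    and t_sep :: int
  assumes "m > 0" and "n > 0" and "r > 0" and "q > 0"
    and "r * m \<le> n" and "q = 2 ^ m"
    and "CARD('a) = q" and "CARD('n) = n"
    and "degree G = r" and "rsquarefree (map_poly to_ac G)"
    and "\<forall>i. irreducible (L i)"
    and "\<forall>i j. i \<noteq> j \<longrightarrow> coprime (L i) (L j)"
    and "\<forall>i. coprime (L i) G"
    and "\<forall>i. poly (map_poly to_ac (L i)) (\<gamma> i) = 0"
    and "l = Max (range (\<lambda>i. degree (L i)))"
    and "d_sep = (2 * real r + 1) / real l"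
    and "t_sep = \<lfloor>real r / real l\<rfloor>"
  shows "ereal d_sep \<le> min_distance (goppa_code L G) \<and>
    t_sep = \<lfloor>d_sep / 2\<rfloor> \<and>
    goppa_code L (G ^ 2) = goppa_code L G \<and>
    (\<forall>c \<in> goppa_code L G. \<forall>e. int (hamming_weight e) \<le> t_sep \<longrightarrow>
      syndrome_decode L (G ^ 2) \<gamma> (c + e) = Some c \<and>
      (\<forall>c' \<in> goppa_code L G. int (hamming_dist (c + e) c') \<le> t_sep \<longrightarrow> c' = c))"
proof -
  let ?C = "goppa_code L G"
  have char: "CHAR('a) = 2"
    using assms(6,7) by (intro CHAR_eq_2) simp
  note sqrt = char_2_exists_sqrt[OF char]
  have degG: "degree G > 0"
    using assms(3,9) by simp
  have irr: "irreducible (L i)" and copG: "coprime (L i) G"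
    and root: "poly (map_poly to_ac (L i)) (\<gamma> i) = 0" for i
    using assms(11,13,14) by blast+
  have cop: "coprime (L i) (L j)" if "i \<noteq> j" for i j
    using assms(12) that by blast
  have copG2: "coprime (L i) (G ^ 2)" for i
    unfolding power2_eq_square using copG copG by (rule coprime_mult_rightI)
  have "degree (G ^ 2) = 2 * degree G"
    using degG by (intro degree_power_eq) auto
  then have degG2: "degree (G ^ 2) = 2 * r"
    using assms(9) by simp
  have le_l: "degree (L i) \<le> l" for i
    unfolding assms(15) by (rule Max_ge) auto
  have l: "l > 0"
    using irreducible_degree_pos[OF irr] le_l less_le_trans by blast
  have code_G2: "goppa_code L (G ^ 2) = ?C"
    by (rule goppa_code_power2[OF char sqrt assms(10) copG degG])
  have code_add: "x + y \<in> ?C" if "x \<in> ?C" "y \<in> ?C" for x y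
    using that char by (simp add: goppa_code_def syndrome_codeword_add)
  have bit_minus: "x - y = x + y" for x y :: "bit ^ 'n"
    by (simp add: vec_eq_iff)
  have dist_eq: "hamming_dist x y = hamming_weight (x + y)" for x y :: "bit ^ 'n"
  proof -
    have "a \<noteq> b \<longleftrightarrow> a + b \<noteq> 0" for a b :: bit
      by (cases a; cases b) auto
    then show ?thesis
      by (simp only: hamming_dist_def hamming_weight_def vector_add_component)
  qed
  \<comment> \<open>This removes the floor, so that the radius becomes the bound
    \<open>l * w\<close> \<le> r on locator degrees.\<close>
  have le_t_iff: "int w \<le> t_sep \<longleftrightarrow> l * w \<le> r" for w
  proof -
    have "int w \<le> t_sep \<longleftrightarrow> real w * real l \<le> real r"
      using l unfolding assms(17) by (simp add: le_floor_iff pos_le_divide_eq)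
    also have "\<dots> \<longleftrightarrow> real (w * l) \<le> real r"
      by simp
    finally show ?thesis
      by (simp only: of_nat_le_iff mult.commute)
  qed
  have min_dist: "ereal d_sep \<le> min_distance ?C"
    unfolding min_distance_def
  proof (rule INF_greatest, clarify)
    fix x y assume xy: "x \<in> ?C" "y \<in> ?C" "x \<noteq> y"
    then have nz: "x + y \<noteq> 0"
      unfolding bit_minus[symmetric] by simp
    have "2 * r + 1 \<le> l * hamming_dist x y"
      unfolding dist_eq assms(9)[symmetric]
      by (rule hamming_weight_codeword[where L = L, OF char sqrt assms(10) irr cop copG degG le_l
            code_add[OF xy(1,2)] nz])
    then have "real (2 * r + 1) \<le> real (l * hamming_dist x y)"
      by (simp only: of_nat_le_iff)
    then show "ereal d_sep \<le> ereal (real (hamming_dist x y))"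
      using l by (simp add: assms(16) pos_divide_le_eq mult.commute)
  qed
  have t_sep: "t_sep = \<lfloor>d_sep / 2\<rfloor>"
  proof -
    have "(2 * real r + 1) / real l / 2 = (2 * real r + 1) / 2 / real l"
      by (simp only: divide_divide_eq_left mult.commute)
    also have "(2 * real r + 1) / 2 = real r + 1 / 2"
      by (simp add: add_divide_distrib)
    finally have "(2 * real r + 1) / real l / 2 = (real r + 1 / 2) / real l" .
    \<comment> \<open>Both floors are compared through the integers z below them: z l and r are
      integers, so the extra 1/2 changes nothing.\<close>
    moreover have "z \<le> \<lfloor>(real r + 1 / 2) / real l\<rfloor> \<longleftrightarrow> z \<le> \<lfloor>real r / real l\<rfloor>" for z
    proof -
      have "real_of_int a \<le> real r + 1 / 2 \<longleftrightarrow> real_of_int a \<le> real r" for a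
      proof (cases "a \<le> int r")
        case True
        then have "real_of_int a \<le> real r" by linarith
        then show ?thesis by linarith
      next
        case False
        then have "real r + 1 \<le> real_of_int a" by linarith
        then show ?thesis by linarith
      qed
      from this[of "z * int l"] show ?thesis
        using l by (simp add: le_floor_iff pos_le_divide_eq)
    qed
    ultimately show ?thesis
      unfolding assms(16,17) by (metis order_antisym order_refl)
  qed
  have decode: "syndrome_decode L (G ^ 2) \<gamma> (c + e) = Some c"
    if "c \<in> ?C" "int (hamming_weight e) \<le> t_sep" for c e
  proof (rule syndrome_decode_correct[OF char sqrt irr cop copG2 _ root])
    show "2 * degree (error_locator L e) \<le> degree (G ^ 2)"
      using degree_error_locator_le[where L = L and y = e, OF le_l] that(2) by (simp add: le_t_iff degG2)
  qed (use that(1) degG2 assms(3) code_G2 in simp_all)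
  have "c' = c" if "c \<in> ?C" "int (hamming_weight e) \<le> t_sep" "c' \<in> ?C"
    "int (hamming_dist (c + e) c') \<le> t_sep" for c c' e
  proof -
    \<comment> \<open>The received word is also \<open>c'\<close> plus an error whose weight is its
      distance to \<open>c'\<close>. The decoder would return both codewords, so they agree.\<close>
    have "c' + (c + e + c') = c + e"
      by (simp add: vec_eq_iff)
    then have "syndrome_decode L (G ^ 2) \<gamma> (c + e) = Some c'"
      using decode[OF that(3), of "c + e + c'"] that(4) by (simp add: dist_eq)
    then show ?thesis
      using decode[OF that(1,2)] by simp
  qed
  with min_dist t_sep code_G2 decode show ?thesis
    by blast
qed

end
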